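(* Let $m\ge 1$ be an integer and let $A_k$ be a set of $k$ positive integers of one of the following two forms. (1) $k=2m$ and $A_k=\{a_1<a_2<\dots<a_{2m}\}$, where $a_1=1$; $a_{i-1}<a_i\le 3a_{i-1}$ for $2\le i\le m$; $a_{m+i}=2a_m-a_{m-i}$ for $1\le i\le m-1$; and $a_{2m}=2a_m$. (2) $k=2m+1$ and $A_k=\{a_1<a_2<\dots<a_m<\hat a_m<a_{m+1}<\dots<a_{2m}\}$, where $a_1=1$; $a_{i-1}<a_i\le 3a_{i-1}$ for $2\le i\le m$; $\hat a_m=a_m+x$ for some integer $x$ with $0<x\le 2a_m$; $a_{m+i}=\hat a_m+a_m-a_{m-i}$ for $1\le i\le m-1$; and $a_{2m}=\hat a_m+a_m$. Then $A_k$ is compact.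
   Context: All $a_i$ (and $\hat a_m$) are positive integers. A set $A_k$ of $k$ positive integers with smallest element $1$ and largest element $M$ is called compact if every integer $n$ with $0\le n\le kM$ can be written as a sum of at most $k$ elements of $A_k$, with repetitions allowed (the empty sum being $0$). In both forms considered, the largest element is $M=a_{2m}$; in the second form the set has $2m+1$ elements, and the extra middle element is denoted $\hat a_m$. *)

theory Defs
  imports Main "HOL-Library.Multiset"
begin

(* Repetitions are allowed in the sums, so the summands form a multiset; the empty
   multiset gives the sum 0. *)
definition compact_basis :: "nat set \<Rightarrow> bool" where
  "compact_basis A \<longleftrightarrow>
     finite A \<and> A \<noteq> {} \<and> Min A = 1 \<and>
     (\<forall>n \<le> card A * Max A.
        \<exists>S. set_mset S \<subseteq> A \<and> size S \<le> card A \<and> sum_mset S = n)"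

(* The sequence a is only constrained on the indices 1, ..., 2m.  By strict monotonicity
   a (m - i) < a m for 1 \<le> i \<le> m - 1, so the natural-number subtractions in this
   definition and the next one never truncate. *)
definition even_form :: "nat \<Rightarrow> nat set \<Rightarrow> bool" where
  "even_form m A \<longleftrightarrow>
     (\<exists>a :: nat \<Rightarrow> nat.
        A = a ` {1..2*m} \<and>
        strict_mono_on {1..2*m} a \<and>
        a 1 = 1 \<and>
        (\<forall>i\<in>{2..m}. a (i - 1) < a i \<and> a i \<le> 3 * a (i - 1)) \<and>
        (\<forall>i\<in>{1..m - 1}. a (m + i) = 2 * a m - a (m - i)) \<and>
        a (2 * m) = 2 * a m)"

definition odd_form :: "nat \<Rightarrow> nat set \<Rightarrow> bool" where
  "odd_form m A \<longleftrightarrow>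
     (\<exists>(a :: nat \<Rightarrow> nat) (b :: nat) (x :: nat).
        A = insert b (a ` {1..2*m}) \<and>
        strict_mono_on {1..2*m} a \<and> a m < b \<and> b < a (m + 1) \<and>
        a 1 = 1 \<and>
        (\<forall>i\<in>{2..m}. a (i - 1) < a i \<and> a i \<le> 3 * a (i - 1)) \<and>
        b = a m + x \<and> 0 < x \<and> x \<le> 2 * a m \<and>
        (\<forall>i\<in>{1..m - 1}. a (m + i) = b + a m - a (m - i)) \<and>
        a (2 * m) = b + a m)"

end

theory Submission
  imports Defs
begin

text \<open>
  Write \<open>M\<close> for the largest element and \<open>B = {a 1, \<dots>, a m}\<close>. In both forms the set, with \<open>0\<close>
  adjoined, is symmetric: it consists of \<open>0\<close>, the elements \<open>y\<close> of \<open>B\<close>, their mirror images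
  \<open>M - y\<close>, and \<open>M\<close>. Padding with \<open>0\<close>, a sum of at most \<open>k\<close> elements therefore has the form
  \<open>q * M + s\<close>, where \<open>q\<close> counts the upper summands \<open>M\<close>, \<open>M - y\<close>, and \<open>s\<close> is a sum of at most
  \<open>k - q\<close> elements of \<open>B\<close> minus a sum of at most \<open>q\<close> elements of \<open>B\<close>. Division by \<open>M\<close>, together
  with the reflection \<open>n \<mapsto> k * M - n\<close>, reduces compactness to offsets \<open>r\<close> with
  \<open>0 \<le> r \<le> M / 2\<close> from a multiple of \<open>M\<close>.

  What is left is a greedy expansion with signs, \<open>signed_sum_greedy\<close>: as \<open>a (i + 1) \<le> 3 * a i\<close>,
  two summands per index bring an offset of at most \<open>a (i + 1)\<close> down to at most \<open>a i\<close>. The number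
  of positive and of negative summands is prescribed, so the positive ones may run out; in that
  case a single positive \<open>a (i + 1)\<close> is spent and the expansion overshoots and continues with
  negative summands, of which there are then plenty.

  In the even form \<open>M / 2 = a m\<close> and the expansion applies at once. In the odd form \<open>M / 2\<close> can
  be as large as \<open>2 * a m\<close>, and the additional summand that is allowed makes up for this.
\<close>

section \<open>Greedy expansion with prescribed numbers of signs\<close>

definition signed_sum :: "nat set \<Rightarrow> nat \<Rightarrow> nat \<Rightarrow> int \<Rightarrow> bool" where
  "signed_sum B p q r \<longleftrightarrow>
     (\<exists>P Q. set_mset P \<subseteq> B \<and> set_mset Q \<subseteq> B \<and> size P \<le> p \<and> size Q \<le> q \<and>
        r = int (sum_mset P) - int (sum_mset Q))"

lemma signed_sum_zero: "signed_sum B p q 0"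
  unfolding signed_sum_def by (intro exI[of _ "{#}"]) auto

lemma signed_sum_uminus:
  assumes "signed_sum B p q r"
  shows "signed_sum B q p (- r)"
  using assms unfolding signed_sum_def by (metis minus_diff_eq)

lemma signed_sum_add:
  assumes "signed_sum B p q r" "y \<in> B"
  shows "signed_sum B (Suc p) q (r + int y)"
proof -
  obtain P Q where "set_mset P \<subseteq> B" "set_mset Q \<subseteq> B" "size P \<le> p" "size Q \<le> q"
    "r = int (sum_mset P) - int (sum_mset Q)"
    using assms(1) unfolding signed_sum_def by blast
  then show ?thesis
    unfolding signed_sum_def using assms(2)
    by (intro exI[of _ "add_mset y P"] exI[of _ Q]) auto
qed

lemma signed_sum_add_pos:
  assumes "signed_sum B (p - 1) q (r - int y)" "y \<in> B" "1 \<le> p"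
  shows "signed_sum B p q r"
  using signed_sum_add[OF assms(1,2)] assms(3) by simp

lemma signed_sum_add_pos2:
  assumes "signed_sum B (p - 2) q (r - 2 * int y)" "y \<in> B" "2 \<le> p"
  shows "signed_sum B p q r"
proof -
  have "signed_sum B (p - 1 - 1) q (r - int y - int y)"
  proof -
    have "p - 2 = p - 1 - 1" "r - 2 * int y = r - int y - int y" by linarith+
    then show ?thesis using assms(1) by metis
  qed
  from signed_sum_add_pos[OF this assms(2)] have "signed_sum B (p - 1) q (r - int y)"
    using assms(3) by simp
  from signed_sum_add_pos[OF this assms(2)] show ?thesis using assms(3) by simp
qed

text \<open>
  Induction on \<open>i\<close>: each step spends at most two summands before it falls back on \<open>r \<le> a i\<close>.
  The bound \<open>p + q \<ge> 2 * i - 1\<close> is tight enough for the odd form, where \<open>2 * m + 1\<close> summands are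
  available and two of them may be spent on \<open>a m\<close> beforehand. Offsets \<open>r < 0\<close> are obtained by
  exchanging \<open>p\<close> and \<open>q\<close>.
\<close>
lemma signed_sum_greedy:
  fixes a :: "nat \<Rightarrow> nat"
  assumes a1: "a 1 = 1"
    and growth: "\<And>i. 1 \<le> i \<Longrightarrow> i < m \<Longrightarrow> a (Suc i) \<le> 3 * a i"
    and i: "1 \<le> i" "i \<le> m"
    and "2 * i \<le> p + q + 1" "0 \<le> r" "r \<le> int (a i)" "1 \<le> p \<or> r = 0"
  shows "signed_sum (a ` {1..m}) p q r"
  using i assms(5-)
proof (induction i arbitrary: p q r rule: nat_induct_at_least)
  case base
  then consider "r = 0" | "r = 1" "1 \<le> p" using a1 by force
  then show ?case
  proof cases
    case 1
    then show ?thesis by (simp add: signed_sum_zero)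
  next
    case 2
    have "1 \<in> a ` {1..m}" using base a1 by (intro rev_image_eqI[of 1]) auto
    then show ?thesis
      using 2 signed_sum_add_pos[of _ p q r 1] by (simp add: signed_sum_zero)
  qed
next
  case (Suc i)
  let ?S = "signed_sum (a ` {1..m})"
  have i: "1 \<le> i" "i < m" using Suc.prems Suc.hyps by auto
  have mem: "a i \<in> a ` {1..m}" "a (Suc i) \<in> a ` {1..m}" using i by auto
  have gr: "int (a (Suc i)) \<le> 3 * int (a i)" using growth[OF i] by linarith
  have IH: "?S p' q' s" if "2 * i \<le> p' + q' + 1" "0 \<le> s" "s \<le> int (a i)" "1 \<le> p' \<or> s = 0"
    for p' q' s using Suc.IH that i by auto
  have IHneg: "?S p' q' s" if "2 * i \<le> p' + q' + 1" "s \<le> 0" "- int (a i) \<le> s" "1 \<le> q'"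
    for p' q' s using signed_sum_uminus[OF IH[of q' p' "- s"]] that by (simp add: add.commute)
  have sub_neg: "?S p' q' s" if "?S p' (q' - 1) (s + int (a i))" "1 \<le> q'" for p' q' s
    using signed_sum_uminus[OF signed_sum_add_pos[OF _ mem(1), of q' p' "- s"]]
      signed_sum_uminus[OF that(1)] that(2) by simp
  consider "r \<le> int (a i)"
    | "int (a i) < r" "r \<le> 2 * int (a i)" "2 \<le> p"
    | "2 * int (a i) < r" "3 \<le> p"
    | "int (a i) < r" "p = 1"
    | "2 * int (a i) < r" "p = 2"
    using Suc.prems by force
  then show ?case
  proof cases
    case 1
    then show ?thesis using Suc.prems by (intro IH) auto
  next
    case 2
    then show ?thesis
      using Suc.prems mem by (intro signed_sum_add_pos[OF IH mem(1)]) auto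
  next
    case 3
    then show ?thesis
      using Suc.prems mem gr by (intro signed_sum_add_pos2[OF IH mem(1)]) auto
  next
    \<comment> \<open>The only positive summand overshoots by less than \<open>2 * a i\<close>; at least \<open>2 * i\<close> negative
      summands remain to correct this, enough to spend one of them on \<open>a i\<close>.\<close>
    case 4
    let ?s = "r - int (a (Suc i))"
    have "?S (p - 1) q ?s"
    proof (cases "- int (a i) \<le> ?s")
      case True
      then show ?thesis using Suc.prems 4 i by (intro IHneg) auto
    next
      case False
      then show ?thesis using Suc.prems 4 i gr by (intro sub_neg[OF IHneg]) auto
    qed
    from signed_sum_add_pos[OF this mem(2)] show ?thesis using 4 by simp
  next
    case 5
    \<comment> \<open>Two copies of \<open>a i\<close> would use up the positive summands, hence one overshooting step.\<close>
    then have "?S (p - 1) q (r - int (a (Suc i)))"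
      using Suc.prems i gr by (intro IHneg) auto
    from signed_sum_add_pos[OF this mem(2)] show ?thesis using 5 by simp
  qed
qed

section \<open>Sums over a symmetric set\<close>

text \<open>
  The sums of exactly \<open>k\<close> elements of the symmetric set made up of \<open>0\<close>, \<open>B\<close>, the mirror images
  \<open>M - y\<close> and \<open>M\<close>, where \<open>q\<close> of the summands come from the upper half.
\<close>
definition reachable :: "nat set \<Rightarrow> nat \<Rightarrow> nat \<Rightarrow> int \<Rightarrow> bool" where
  "reachable B M k n \<longleftrightarrow> (\<exists>p q. p + q = k \<and> signed_sum B p q (n - int q * int M))"

lemma reachableI:
  assumes "signed_sum B p q r" "p + q = k" "n = int q * int M + r"
  shows "reachable B M k n"
  using assms unfolding reachable_def by (metis add_diff_cancel_left')

lemma reachable_reflect: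
  assumes "reachable B M k n"
  shows "reachable B M k (int k * int M - n)"
proof -
  obtain p q where pq: "p + q = k" "signed_sum B p q (n - int q * int M)"
    using assms unfolding reachable_def by blast
  show ?thesis
    by (rule reachableI[OF signed_sum_uminus[OF pq(2)]])
      (use pq(1) in \<open>auto simp: algebra_simps\<close>)
qed

text \<open>
  A remainder modulo \<open>M\<close> above \<open>M / 2\<close> turns into one below \<open>M / 2\<close> under the reflection
  \<open>n \<mapsto> k * M - n\<close>.
\<close>
lemma reachable_all:
  assumes "0 < M"
    and half: "\<And>p q r. p + q = k \<Longrightarrow> 0 \<le> r \<Longrightarrow> 2 * r \<le> int M \<Longrightarrow> 1 \<le> p \<or> r = 0 \<Longrightarrow>
        reachable B M k (int q * int M + r)"
    and n: "n \<le> k * M"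
  shows "reachable B M k (int n)"
proof -
  define q r where "q = n div M" and "r = n mod M"
  have nqr: "n = q * M + r" and r: "r < M"
    using assms(1) by (auto simp: q_def r_def)
  have qk: "q \<le> k"
    using div_le_mono[OF n, of M] assms(1) by (simp add: q_def)
  have "q < k" if "0 < r"
  proof (rule ccontr)
    assume "\<not> q < k"
    then have "q = k" using qk by simp
    then show False using that n nqr by simp
  qed
  then have p: "1 \<le> k - q \<or> r = 0" by auto
  show ?thesis
  proof (cases "2 * r \<le> M")
    case True
    have "reachable B M k (int q * int M + int r)"
      using True qk p by (intro half[of "k - q"]) auto
    then show ?thesis by (simp add: nqr)
  next
    case False
    then have qk': "q < k" using p by auto
    then obtain d where d: "k = Suc (q + d)" using less_imp_Suc_add by blast
    have "reachable B M k (int d * int M + (int M - int r))"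
      using False d r by (intro half[of "Suc q"]) auto
    from reachable_reflect[OF this] show ?thesis
      by (simp add: nqr d algebra_simps)
  qed
qed

text \<open>Each upper summand is written as \<open>M\<close>, or as \<open>M - y\<close> when it absorbs a negative \<open>y\<close>.\<close>
lemma reachable_imp_mset:
  assumes "reachable B M k (int n)" "B \<subseteq> A" "M \<in> A"
    and mirror: "\<And>y. y \<in> B \<Longrightarrow> y \<le> M \<and> M - y \<in> A"
  shows "\<exists>S. set_mset S \<subseteq> A \<and> size S \<le> k \<and> sum_mset S = n"
proof -
  obtain p q P Q where pq: "p + q = k" and PQ: "set_mset P \<subseteq> B" "set_mset Q \<subseteq> B"
    "size P \<le> p" "size Q \<le> q" "int n - int q * int M = int (sum_mset P) - int (sum_mset Q)"
    using assms(1) unfolding reachable_def signed_sum_def by blast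
  have "(\<Sum>y\<in>#Q. M - y) + sum_mset Q = size Q * M"
    using PQ(2) mirror by (induction Q) force+
  then have mirror_sum: "int (\<Sum>y\<in>#Q. M - y) = int (size Q) * int M - int (sum_mset Q)"
    by (metis add_diff_cancel_right' of_nat_add of_nat_mult)
  obtain e where e: "q = size Q + e" using PQ(4) le_Suc_ex by blast
  define S where "S = P + image_mset (\<lambda>y. M - y) Q + replicate_mset e M"
  have "sum_mset S = sum_mset P + (\<Sum>y\<in>#Q. M - y) + e * M"
    by (simp add: S_def)
  then have "int (sum_mset S) = int (sum_mset P) + int (\<Sum>y\<in>#Q. M - y) + int e * int M"
    by (simp only: of_nat_add of_nat_mult)
  then have "int (sum_mset S) = int n"
    using PQ(5) unfolding mirror_sum e of_nat_add distrib_right by linarith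
  moreover have "set_mset S \<subseteq> A"
    using PQ(1,2) assms(2,3) mirror by (auto simp: S_def)
  moreover have "size S \<le> k"
    using PQ(3) pq by (simp add: S_def e)
  ultimately show ?thesis by (metis of_nat_eq_iff)
qed

section \<open>Covering all targets\<close>

lemma reachable_even:
  fixes a :: "nat \<Rightarrow> nat"
  assumes "1 \<le> m" "a 1 = 1" "\<And>i. 1 \<le> i \<Longrightarrow> i < m \<Longrightarrow> a (Suc i) \<le> 3 * a i"
    and "0 < a m" "n \<le> 2 * m * (2 * a m)"
  shows "reachable (a ` {1..m}) (2 * a m) (2 * m) (int n)"
proof (rule reachable_all)
  fix p q :: nat and r :: int
  assume "p + q = 2 * m" "0 \<le> r" "2 * r \<le> int (2 * a m)" "1 \<le> p \<or> r = 0"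
  then show "reachable (a ` {1..m}) (2 * a m) (2 * m) (int q * int (2 * a m) + r)"
    by (intro reachableI[of _ p q r] signed_sum_greedy[where i = m] assms) auto
qed (use assms in auto)

lemma reachable_odd:
  fixes a :: "nat \<Rightarrow> nat"
  assumes m: "1 \<le> m" and a: "a 1 = 1" "\<And>i. 1 \<le> i \<Longrightarrow> i < m \<Longrightarrow> a (Suc i) \<le> 3 * a i"
    and M: "0 < M" "M \<le> 4 * a m" and n: "n \<le> (2 * m + 1) * M"
  shows "reachable (a ` {1..m}) M (2 * m + 1) (int n)"
proof (rule reachable_all)
  fix p q :: nat and r :: int
  assume pq: "p + q = 2 * m + 1" and r: "0 \<le> r" "2 * r \<le> int M" "1 \<le> p \<or> r = 0"
  let ?S = "signed_sum (a ` {1..m})"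
  have mem: "a m \<in> a ` {1..m}" using m by auto
  have greedy: "?S p' q' s"
    if "2 * m \<le> p' + q' + 1" "0 \<le> s" "s \<le> int (a m)" "1 \<le> p' \<or> s = 0" for p' q' s
    using that m by (intro signed_sum_greedy[where i = m] a) auto
  consider "r \<le> int (a m)" | "int (a m) < r" "2 \<le> p" | "int (a m) < r" "p = 1"
    using r by force
  then show "reachable (a ` {1..m}) M (2 * m + 1) (int q * int M + r)"
  proof cases
    case 1
    then show ?thesis using pq r by (intro reachableI[of _ p q r] greedy) auto
  next
    case 2
    have "?S p q r"
      using 2 pq r M by (intro signed_sum_add_pos[OF greedy mem]) auto
    then show ?thesis using pq by (intro reachableI) auto
  next
    case 3
    \<comment> \<open>The single lower summand is too small to reach \<open>r\<close>, so it is moved to the upper half: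
      the target lies \<open>M - r \<le> 3 * a m\<close> below the next multiple of \<open>M\<close>.\<close>
    let ?t = "int M - r"
    have t: "0 \<le> ?t" "?t \<le> 3 * int (a m)" using 3 r M by auto
    consider "?t \<le> int (a m)" | "int (a m) < ?t" "?t \<le> 2 * int (a m)" | "2 * int (a m) < ?t"
      by linarith
    then have "?S (2 * m + 1) 0 ?t"
    proof cases
      case 1
      then show ?thesis using t by (intro greedy) auto
    next
      case 2
      then show ?thesis
        using m by (intro signed_sum_add_pos[OF greedy mem]) auto
    next
      case 3
      then show ?thesis
        using t m by (intro signed_sum_add_pos2[OF greedy mem]) auto
    qed
    from signed_sum_uminus[OF this] show ?thesis
      using 3 pq by (intro reachableI[of _ 0 "2 * m + 1" "- ?t"]) (auto simp: algebra_simps)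
  qed
qed (use assms in auto)

section \<open>The two forms\<close>

lemma compact_basisI:
  assumes "finite A" "card A = k" "1 \<in> A" "M \<in> A" "\<And>x. x \<in> A \<Longrightarrow> 1 \<le> x \<and> x \<le> M"
    and "\<And>n. n \<le> k * M \<Longrightarrow> reachable B M k (int n)"
    and "B \<subseteq> A" "\<And>y. y \<in> B \<Longrightarrow> M - y \<in> A"
  shows "compact_basis A"
proof -
  have "Min A = 1" "Max A = M"
    using assms by (auto intro!: Min_eqI Max_eqI)
  moreover have "\<exists>S. set_mset S \<subseteq> A \<and> size S \<le> k \<and> sum_mset S = n" if "n \<le> k * M" for n
    using assms that by (intro reachable_imp_mset[where B = B and M = M]) auto
  ultimately show ?thesis using assms(1-3) unfolding compact_basis_def by auto
qed

lemma even_form_compact: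
  assumes m: "1 \<le> m" and fin: "finite A" and k: "card A = 2 * m"
    and "even_form m A"
  shows "compact_basis A"
proof -
  obtain a where A: "A = a ` {1..2 * m}" and mono: "strict_mono_on {1..2 * m} a"
    and a1: "a 1 = 1" and growth: "\<forall>i\<in>{2..m}. a (i - 1) < a i \<and> a i \<le> 3 * a (i - 1)"
    and sym: "\<forall>i\<in>{1..m - 1}. a (m + i) = 2 * a m - a (m - i)" and top: "a (2 * m) = 2 * a m"
    using assms(4) unfolding even_form_def by blast
  have mem: "a j \<in> A" if "1 \<le> j" "j \<le> 2 * m" for j using that by (auto simp: A)
  have gr: "a (Suc i) \<le> 3 * a i" if "1 \<le> i" "i < m" for i
    using growth[rule_format, of "Suc i"] that by auto
  have le: "a i \<le> a j" if "1 \<le> i" "i \<le> j" "j \<le> 2 * m" for i j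
    using strict_mono_on_leD[OF mono, of i j] that by auto
  have am: "0 < a m" using le[of 1 m] m a1 by simp
  show ?thesis
  proof (rule compact_basisI[OF fin k])
    show "1 \<in> A" using mem[of 1] m a1 by simp
    show "2 * a m \<in> A" using mem[of "2 * m"] m top by simp
    show "1 \<le> x \<and> x \<le> 2 * a m" if x: "x \<in> A" for x
    proof -
      obtain j where "1 \<le> j" "j \<le> 2 * m" "x = a j" using x by (auto simp: A)
      then show ?thesis using le[of 1 j] le[of j "2 * m"] a1 top by simp
    qed
    show "reachable (a ` {1..m}) (2 * a m) (2 * m) (int n)" if "n \<le> 2 * m * (2 * a m)" for n
      using that m a1 gr am by (intro reachable_even) auto
    show "a ` {1..m} \<subseteq> A" by (auto simp: A)
    show "2 * a m - y \<in> A" if y: "y \<in> a ` {1..m}" for y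
    proof -
      obtain j where j: "1 \<le> j" "j \<le> m" "y = a j" using y by auto
      show ?thesis
      proof (cases "j = m")
        case True
        then show ?thesis using j mem[of m] by simp
      next
        case False
        then have "m - j \<in> {1..m - 1}" "m - (m - j) = j" using j by auto
        then have "a (m + (m - j)) = 2 * a m - a j" using sym by fastforce
        then show ?thesis using mem[of "m + (m - j)"] j by auto
      qed
    qed
  qed
qed

lemma odd_form_compact:
  assumes m: "1 \<le> m" and fin: "finite A" and k: "card A = 2 * m + 1"
    and "odd_form m A"
  shows "compact_basis A"
proof -
  obtain a b x where A: "A = insert b (a ` {1..2 * m})"
    and mono: "strict_mono_on {1..2 * m} a" and bl: "a m < b"
    and a1: "a 1 = 1" and growth: "\<forall>i\<in>{2..m}. a (i - 1) < a i \<and> a i \<le> 3 * a (i - 1)"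
    and b: "b = a m + x" and x: "x \<le> 2 * a m"
    and sym: "\<forall>i\<in>{1..m - 1}. a (m + i) = b + a m - a (m - i)" and top: "a (2 * m) = b + a m"
    using assms(4) unfolding odd_form_def by blast
  have mem: "a j \<in> A" if "1 \<le> j" "j \<le> 2 * m" for j using that by (auto simp: A)
  have gr: "a (Suc i) \<le> 3 * a i" if "1 \<le> i" "i < m" for i
    using growth[rule_format, of "Suc i"] that by auto
  have le: "a i \<le> a j" if "1 \<le> i" "i \<le> j" "j \<le> 2 * m" for i j
    using strict_mono_on_leD[OF mono, of i j] that by auto
  show ?thesis
  proof (rule compact_basisI[OF fin k])
    show "1 \<in> A" using mem[of 1] m a1 by simp
    show "b + a m \<in> A" using mem[of "2 * m"] m top by simp
    show "1 \<le> y \<and> y \<le> b + a m" if y: "y \<in> A" for y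
    proof (cases "y = b")
      case True
      then show ?thesis using bl by simp
    next
      case False
      then obtain j where "1 \<le> j" "j \<le> 2 * m" "y = a j" using y by (auto simp: A)
      then show ?thesis using le[of 1 j] le[of j "2 * m"] a1 top by simp
    qed
    show "reachable (a ` {1..m}) (b + a m) (2 * m + 1) (int n)"
      if "n \<le> (2 * m + 1) * (b + a m)" for n
      using that m a1 gr bl b x by (intro reachable_odd) auto
    show "a ` {1..m} \<subseteq> A" by (auto simp: A)
    show "b + a m - y \<in> A" if y: "y \<in> a ` {1..m}" for y
    proof -
      obtain j where j: "1 \<le> j" "j \<le> m" "y = a j" using y by auto
      show ?thesis
      proof (cases "j = m")
        case True
        then show ?thesis using j by (simp add: A)
      next
        case False
        then have "m - j \<in> {1..m - 1}" "m - (m - j) = j" using j by auto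
        then have "a (m + (m - j)) = b + a m - a j" using sym by fastforce
        then show ?thesis using mem[of "m + (m - j)"] j by auto
      qed
    qed
  qed
qed

theorem theorem2p2:
  fixes m k :: nat and A :: "nat set"
  assumes "m \<ge> 1"
    and "finite A" and "card A = k" and "\<forall>a\<in>A. 0 < a"
    and "(k = 2 * m \<and> even_form m A) \<or> (k = 2 * m + 1 \<and> odd_form m A)"
  shows "compact_basis A"
  using assms even_form_compact odd_form_compact by blast

end
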